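(* Let $a$ be a rational number with $2<a<\frac{24}{7}$. Then there are infinitely many ESPP instances $(n,k,P)$ with $n/k=a$ that are not solvable.
   Context: For positive integers $n,k$ with $k$ dividing $n(n+1)/2$, put $s^{n,k}=\frac{n(n+1)}{2k}$. For a non-descending sequence of positive integers $P=[p_1,\dots,p_k]$ with $p_1+\cdots+p_k=n$ (a non-descending composition of $n$), let $P_j=\sum_{i=1}^j p_i$, $\mathrm{slack}_j(P)=\sum_{i=1}^{P_j}(n-i+1)-j\,s^{n,k}$ for $1\le j\le k-1$, and $\mathrm{slack}(P)=\min_{1\le j<k}\mathrm{slack}_j(P)$. An ESPP instance is a triple $(n,k,P)$ where $n,k$ are positive integers with $k\mid n(n+1)/2$ and $P$ is a non-descending composition of $n$ into $k$ parts with $\mathrm{slack}(P)\ge 0$. It is solvable if $\{1,\dots,n\}$ can be partitioned into sets $A_1,\dots,A_k$ with $|A_j|=p_j$ and $\sum_{x\in A_j}x=s^{n,k}$ for every $j$. *)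

theory Defs
  imports Complex_Main "HOL-Library.Disjoint_Sets" "HOL-Library.Extended_Real"
begin

text \<open>Only used when \<open>k\<close> divides \<open>n (n + 1) / 2\<close>, in which case the division is exact.\<close>

definition target_sum :: "nat \<Rightarrow> nat \<Rightarrow> nat" where
  "target_sum n k = (n * (n + 1)) div (2 * k)"

definition nondescending_composition :: "nat \<Rightarrow> nat \<Rightarrow> nat list \<Rightarrow> bool" where
  "nondescending_composition n k P \<longleftrightarrow>
     length P = k \<and> sorted P \<and> (\<forall>p \<in> set P. 0 < p) \<and> sum_list P = n"

definition partial_sum :: "nat list \<Rightarrow> nat \<Rightarrow> nat" where
  "partial_sum P j = sum_list (take j P)"

definition slack_at :: "nat \<Rightarrow> nat \<Rightarrow> nat list \<Rightarrow> nat \<Rightarrow> int" where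
  "slack_at n k P j =
     (\<Sum>i = 1..partial_sum P j. int n - int i + 1) - int j * int (target_sum n k)"

text \<open>
  The infimum over the finite index set is a minimum when \<open>k \<ge> 2\<close>; for \<open>k = 1\<close> the
  minimum over the empty set is \<open>\<infinity>\<close>, so that the slack condition is vacuous.
\<close>

definition slack :: "nat \<Rightarrow> nat \<Rightarrow> nat list \<Rightarrow> ereal" where
  "slack n k P = (INF j \<in> {1..<k}. ereal (of_int (slack_at n k P j)))"

definition ESPP_instance :: "nat \<Rightarrow> nat \<Rightarrow> nat list \<Rightarrow> bool" where
  "ESPP_instance n k P \<longleftrightarrow>
     0 < n \<and> 0 < k \<and> k dvd (n * (n + 1)) div 2 \<and>
     nondescending_composition n k P \<and> 0 \<le> slack n k P"

text \<open>The blocks and the list \<open>P\<close> are indexed from \<open>0\<close>.\<close>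

definition ESPP_solvable :: "nat \<Rightarrow> nat \<Rightarrow> nat list \<Rightarrow> bool" where
  "ESPP_solvable n k P \<longleftrightarrow>
     (\<exists>A :: nat \<Rightarrow> nat set.
        disjoint_family_on A {..<k} \<and> (\<Union>j<k. A j) = {1..n} \<and>
        (\<forall>j<k. card (A j) = P ! j \<and> \<Sum>(A j) = target_sum n k))"

end

theory Submission
  imports Defs
begin

text \<open>
  Let \<open>s = n (n + 1) / (2 k)\<close> and \<open>r = s - n - 1\<close>. A block of size \<open>2\<close> must lie in
  \<open>{r+1..n}\<close>, so \<open>p\<close> such blocks leave only \<open>L = n - r - 2 p\<close> elements of \<open>{r+1..n}\<close>, and
  among \<open>u + L\<close> further blocks of size \<open>g\<close> at least \<open>u\<close> lie inside \<open>{1..r}\<close>. This is impossible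
  once the largest \<open>g u\<close> elements of \<open>{1..r}\<close> add up to less than \<open>u s\<close>. The slack does not
  notice: each of the \<open>L\<close> left over elements contributes a surplus of order \<open>n\<close>, so a large constant
  \<open>L\<close> compensates the deficit. For \<open>a \<le> 3\<close> one takes \<open>u = 1\<close> and \<open>g = \<lfloor>2 / (a - 2)\<rfloor> + 1\<close>, for
  \<open>a > 3\<close> one takes \<open>g = 3\<close> and the least possible \<open>u\<close>, about \<open>2 (a - 3) n / 9\<close>; then the surplus
  per element is \<open>(4 - 7 a / 6) n / 2\<close>, whence the bound \<open>24 / 7\<close>. The remaining \<open>R\<close> numbers are
  split into blocks whose sizes differ by at most one.
\<close>

section \<open>Extremal subset sums and the slack criterion\<close>

text \<open>The extreme case consists of the \<open>card S\<close> largest elements of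
  \<open>{1..r}\<close>. Doubling and moving the square to the left avoid division and truncated
  subtraction.\<close>

lemma sum_subset_le:
  fixes S :: "nat set"
  assumes "S \<subseteq> {1..r}"
  shows "2 * \<Sum>S + card S * card S \<le> card S * (2 * r + 1)"
  using assms
proof (induction r arbitrary: S)
  case 0
  then show ?case by simp
next
  case (Suc r)
  have fin: "finite S" using Suc.prems finite_subset by blast
  show ?case
  proof (cases "Suc r \<in> S")
    case True
    define S' where "S' = S - {Suc r}"
    have sub: "S' \<subseteq> {1..r}" using Suc.prems by (auto simp: S'_def le_Suc_eq)
    have "card S = Suc (card S')" "\<Sum>S = Suc r + \<Sum>S'"
      unfolding S'_def using card.remove[OF fin True] sum.remove[OF fin True, of id] by simp_all
    with Suc.IH[OF sub] show ?thesis by (simp add: algebra_simps)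
  next
    case False
    then have "S \<subseteq> {1..r}" using Suc.prems by (simp add: atLeastAtMostSuc_conv subset_insert)
    from Suc.IH[OF this] show ?thesis by (simp add: algebra_simps)
  qed
qed

lemma target_sum_eqI:
  assumes "2 * k * s = n * (n + 1)" and "0 < k"
  shows "target_sum n k = s"
  unfolding target_sum_def assms(1)[symmetric] using assms(2) by simp

lemma sum_descending_eq: "2 * (\<Sum>i = 1..m. int n - int i + 1) = int m * (2 * int n - int m + 1)"
  by (induction m) (auto simp: algebra_simps)

lemma ESPP_instanceI:
  assumes "2 * k * s = n * (n + 1)" and "0 < n" and "0 < k"
    and "nondescending_composition n k P"
    and slack: "\<And>j. j \<le> k \<Longrightarrow> 2 * int j * int s \<le> int (partial_sum P j) * (2 * int n - int (partial_sum P j) + 1)"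
  shows "ESPP_instance n k P"
proof -
  have "0 \<le> slack_at n k P j" if "j \<le> k" for j
    using slack[OF that] sum_descending_eq[of n "partial_sum P j"] target_sum_eqI[OF assms(1,3)]
    by (simp add: slack_at_def)
  then have "0 \<le> slack n k P"
    by (auto simp: slack_def le_INF_iff)
  moreover have "k dvd (n * (n + 1)) div 2"
    unfolding assms(1)[symmetric] by (simp add: mult.assoc)
  ultimately show ?thesis using assms by (simp add: ESPP_instance_def)
qed

text \<open>This yields sortedness: the last \<open>K\<close> blocks, of total size
  \<open>R\<close>, have average size at least \<open>g\<close>. One splits
  \<open>r (r + 1) = R (R + 1) + (r - R) (r + R + 1)\<close> and bounds both parts by
  \<open>crowded\<close>.\<close>

lemma block_count_bound:
  fixes g r s u L M R K :: int
  assumes r: "r = g * u + M + R" and M: "M = (g - 1) * L"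
    and K: "2 * K * s = r * (r + 1) - (2 * u + L) * s"
    and crowded: "2 * g * r + g < 2 * s + g * g * u"
    and pos: "1 \<le> g" "1 \<le> u" "0 \<le> L" "0 \<le> M" "0 \<le> R" "0 < s"
    and ge: "M \<le> R"
  shows "g * K \<le> R"
proof -
  have "g * (r + R + 1 + M) = 2 * g * r + g - g * g * u"
    unfolding r by (simp add: algebra_simps)
  then have c: "g * (r + R + 1 + M) < 2 * s" using crowded by linarith
  have "0 < g * u" using pos by simp
  then have "R + 1 \<le> r" unfolding r using \<open>0 \<le> M\<close> by linarith
  then have "2 * (R + 1) \<le> r + R + 1 + M" using \<open>0 \<le> M\<close> by presburger
  then have "g * (2 * (R + 1)) \<le> g * (r + R + 1 + M)" using pos by (intro mult_left_mono) auto
  then have gR: "g * (R + 1) \<le> s" using c by linarith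
  have "0 \<le> g * M" using pos by simp
  then have c': "g * (r + R + 1) \<le> 2 * s" using c by (simp only: distrib_left)
  have rR: "r - R = g * u + M" using r by simp
  have "0 \<le> r - R" using rR pos by simp
  have "g * (2 * K * s) = R * (g * (R + 1)) + (r - R) * (g * (r + R + 1)) - g * (2 * u + L) * s"
    unfolding K by (simp add: algebra_simps)
  also have "\<dots> \<le> R * s + (r - R) * (2 * s) - g * (2 * u + L) * s"
    using mult_left_mono[OF gR \<open>0 \<le> R\<close>] mult_left_mono[OF c' \<open>0 \<le> r - R\<close>] by linarith
  \<comment> \<open>\<open>2 (g u + M) - g (2 u + L) = 2 M - g L\<close>, and this is
    \<open>M - L\<close> because \<open>M = (g - 1) L\<close>.\<close>
  also have "\<dots> = R * s + (M - L) * s"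
    unfolding rR M by (simp add: algebra_simps)
  also have "\<dots> \<le> R * s + R * s"
    using pos ge by (intro add_left_mono mult_right_mono) auto
  finally have "(g * K) * (2 * s) \<le> R * (2 * s)" by (simp add: algebra_simps)
  then show ?thesis using pos by simp
qed

section \<open>The instance and its composition\<close>

locale crowded_blocks =
  fixes n k s r p u L G R :: nat
  assumes sum_eq: "2 * k * s = n * (n + 1)"
    and s_eq: "s = n + 1 + r"
    and n_eq: "n = r + 2 * p + L"
    and r_eq: "r = Suc G * u + G * L + R"
    and u_pos: "0 < u" and G_ge: "2 \<le> G" and R_pos: "0 < R"
    and crowded: "2 * Suc G * r + Suc G < 2 * s + Suc G * Suc G * u"
    and slack_nonneg: "(2 * u + L) * s + R * (R + 1) \<le> r * (r + 1)"
    and R_ge: "G * L \<le> R"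
begin

definition K :: nat where "K = k - (p + u + L)"
definition h :: nat where "h = R div K"
definition e :: nat where "e = R mod K"
definition Q :: "nat list" where "Q = replicate (K - e) h @ replicate e (Suc h)"
definition P :: "nat list" where "P = replicate p 2 @ replicate (u + L) (Suc G) @ Q"

lemma s_pos: "0 < s" using s_eq by simp
lemma n_pos: "0 < n" using R_pos r_eq n_eq by simp
lemma k_pos: "0 < k"
  using sum_eq n_pos by (cases k) auto

lemma sum_eq_int: "2 * int k * int s = int n * (int n + 1)"
  using sum_eq[THEN arg_cong[where f = int]]
  by (simp only: of_nat_add of_nat_mult of_nat_numeral of_nat_1)

text \<open>With \<open>2 p + L = n - r\<close> and \<open>s = n + r + 1\<close>, the product
  \<open>(2 p + L) s\<close> is twice the sum of \<open>{r+1..n}\<close>. Integers are used because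
  \<open>p + u + L \<le> k\<close> is not yet known.\<close>

lemma rest_eq: "2 * (int k - int p - int u - int L) * int s = int r * (int r + 1) - (2 * int u + int L) * int s"
proof -
  have "2 * int k * int s = int n * (int n + 1)" by (rule sum_eq_int)
  moreover have s: "int s = int n + 1 + int r" and pL: "2 * int p + int L = int n - int r"
    using s_eq n_eq by simp_all
  have "(2 * int p + int L) * int s = int n * (int n + 1) - int r * (int r + 1)"
    unfolding s pL by (simp add: algebra_simps)
  ultimately show ?thesis by (simp add: algebra_simps)
qed

lemma slack_nonneg_int: "(2 * int u + int L) * int s + int R * (int R + 1) \<le> int r * (int r + 1)"
  using slack_nonneg[THEN of_nat_mono[where 'a = int]]
  by (simp only: of_nat_add of_nat_mult of_nat_numeral of_nat_1)

text \<open>The subtraction in \<open>K\<close> does not truncate: \<open>slack_nonneg\<close> and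
  \<open>0 < R\<close> make the right side of \<open>rest_eq\<close> positive.\<close>

lemma k_eq: "k = p + u + L + K" and K_pos: "0 < K"
proof -
  have "0 < int R * (int R + 1)" using R_pos by simp
  then have "0 < 2 * (int k - int p - int u - int L) * int s" using rest_eq slack_nonneg_int by linarith
  then have "0 < int k - int p - int u - int L" using s_pos by (simp add: zero_less_mult_iff)
  then show "k = p + u + L + K" "0 < K" by (auto simp: K_def)
qed

lemma K_eq: "2 * int K * int s = int r * (int r + 1) - (2 * int u + int L) * int s"
  proof -
  have "int K = int k - int p - int u - int L" using k_eq by simp
  then show ?thesis using rest_eq by simp
qed

text \<open>\<open>slack_nonneg\<close> seen from the other end: the numbers \<open>1..R\<close> sum
  to at most \<open>K s\<close>.\<close>

lemma R_le: "R * (R + 1) \<le> 2 * K * s"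
proof -
  have "int R * (int R + 1) \<le> 2 * int K * int s" using K_eq slack_nonneg_int by linarith
  then have "int (R * (R + 1)) \<le> int (2 * K * s)" by (simp only: of_nat_add of_nat_mult of_nat_numeral of_nat_1)
  then show ?thesis by linarith
qed

lemma h_ge: "Suc G \<le> h"
proof -
  have "(int G + 1) * int K \<le> int R"
  proof (rule block_count_bound[of "int r" _ "int u" "int G * int L" _ "int L" _ "int s"])
    show "int r = (int G + 1) * int u + int G * int L + int R"
      using r_eq by (simp add: algebra_simps)
    show "2 * (int G + 1) * int r + (int G + 1) < 2 * int s + (int G + 1) * (int G + 1) * int u"
      using crowded[THEN of_nat_less_iff[where 'a = int, THEN iffD2]]
      by (simp only: of_nat_add of_nat_mult of_nat_numeral of_nat_Suc add.commute)
    show "int G * int L \<le> int R" using R_ge by (metis of_nat_mono of_nat_mult)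
  qed (use K_eq u_pos s_pos in auto)
  then have "int (Suc G * K) \<le> int R" by (simp only: of_nat_mult of_nat_Suc add.commute)
  then have "Suc G * K \<le> R" by linarith
  then show ?thesis using K_pos by (simp add: h_def less_eq_div_iff_mult_less_eq)
qed

lemma e_less: "e < K" using K_pos by (simp add: e_def)
lemma R_split: "R = K * h + e" by (simp add: h_def e_def)

lemma length_Q: "length Q = K" using e_less by (simp add: Q_def)

lemma sum_list_Q: "sum_list Q = R"
proof -
  have "K * h = (K - e) * h + e * h" using e_less by (simp flip: add_mult_distrib)
  then show ?thesis using R_split by (simp add: Q_def sum_list_replicate)
qed

lemma composition: "nondescending_composition n k P"
proof -
  have "sum_list P = n"
    using n_eq r_eq by (simp add: P_def sum_list_Q sum_list_replicate algebra_simps)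
  moreover have "sorted P" "\<forall>x\<in>set P. 0 < x"
    using h_ge G_ge by (auto simp: P_def Q_def sorted_append)
  moreover have "length P = k" using length_Q k_eq by (simp add: P_def)
  ultimately show ?thesis by (simp add: nondescending_composition_def)
qed

section \<open>Nonnegative slack\<close>

lemma sum_list_drop_Q:
  assumes "i \<le> K"
  shows "sum_list (drop (K - i) Q) = i * h + min i e"
proof (cases "i \<le> e")
  case True
  then have "drop (K - i) Q = replicate i (Suc h)" using e_less assms by (simp add: Q_def)
  then show ?thesis using True by (simp add: sum_list_replicate)
next
  case False
  then have "drop (K - i) Q = replicate (i - e) h @ replicate e (Suc h)" using e_less assms by (simp add: Q_def)
  moreover have "i * h = (i - e) * h + e * h" using False by (simp flip: add_mult_distrib)
  ultimately show ?thesis using False by (simp add: sum_list_replicate)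
qed

text \<open>The average \<open>W (W + 1) / i\<close> over the last \<open>i\<close> blocks, \<open>W\<close> being their total size,
  increases with \<open>i\<close>, so the case \<open>i = K\<close> controls all of them.\<close>

lemma tail_sum_le:
  assumes "i \<le> K"
  shows "(i * h + min i e) * (i * h + min i e + 1) \<le> 2 * i * s"
proof -
  define W where "W = (\<lambda>i. i * h + min i e)"
  have h1: "1 \<le> h" using h_ge by simp
  have mean_step: "W i * (W i + 1) * Suc i \<le> W (Suc i) * (W (Suc i) + 1) * i" if "1 \<le> i" for i
  proof (cases "i < e")
    case True
    then show ?thesis by (simp add: W_def min_def algebra_simps)
  next
    case False
    then have W: "W i = i * h + e" "W (Suc i) = i * h + e + h" by (auto simp: W_def)
    \<comment> \<open>After expansion the difference of the two sides of \<open>mean_step\<close> is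
      exactly \<open>i (i + 1) h h - e (e + 1)\<close>.\<close>
    have "e * (e + 1) \<le> i * (i + 1)" using False by (intro mult_mono) auto
    also have "\<dots> \<le> (i * (i + 1)) * (h * h)" using h1 by simp
    finally show ?thesis unfolding W by (simp add: algebra_simps)
  qed
  have mono: "W i * (W i + 1) * K \<le> R * (R + 1) * i" if "1 \<le> i" "i \<le> K" for i
    using that(2)
  proof (induction rule: inc_induct)
    case base
    have "W K = R" using R_split e_less by (simp add: W_def)
    then show ?case by simp
  next
    case (step m)
    have m: "1 \<le> m" using step.hyps that by simp
    have "(W m * (W m + 1) * K) * Suc m \<le> (W (Suc m) * (W (Suc m) + 1) * K) * m"
      using mult_right_mono[OF mean_step[OF m], of K] by (simp only: ac_simps)
    also have "\<dots> \<le> (R * (R + 1) * Suc m) * m" using step.IH by (intro mult_right_mono) auto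
    finally have "(W m * (W m + 1) * K) * Suc m \<le> (R * (R + 1) * m) * Suc m"
      by (simp only: mult.assoc mult.commute[of m "Suc m"])
    then show ?case by (simp only: mult_le_cancel2)
  qed
  show ?thesis
  proof (cases "i = 0")
    case False
    have "W i * (W i + 1) * K \<le> R * (R + 1) * i" using mono[of i] False assms by simp
    also have "\<dots> \<le> 2 * K * s * i" using R_le by (intro mult_right_mono) auto
    finally have "(W i * (W i + 1)) * K \<le> (2 * i * s) * K" by (simp add: algebra_simps)
    then show ?thesis using K_pos by (simp only: mult_le_cancel2 W_def)
  qed simp
qed

text \<open>Up to the factor \<open>2 j\<close> this is \<open>2 j \<le> 2 n + 1 - s\<close>, where
  \<open>2 n + 1 - s = n - r = 2 p + L\<close>.\<close>

lemma slack_pairs: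
  assumes "j \<le> p"
  shows "2 * int j * int s \<le> (2 * int j) * (2 * int n - 2 * int j + 1)"
  using assms s_eq n_eq by (intro mult_left_mono) auto

text \<open>The slack is a concave function of \<open>i\<close>, nonnegative for \<open>i = 0\<close> and \<open>i = u + L\<close>.\<close>

lemma slack_middle:
  assumes "i \<le> u + L"
  shows "2 * (int p + int i) * int s
    \<le> (2 * int p + int (Suc G) * int i) * (2 * int n - (2 * int p + int (Suc G) * int i) + 1)"
proof (cases "u + L = 0")
  case False
  define g where "g = int (Suc G)"
  define t where "t = int u + int L"
  define F :: "int \<Rightarrow> int" where
    "F i = (2 * int p + g * i) * (2 * int n - (2 * int p + g * i) + 1) - 2 * (int p + i) * int s" for i
  have "0 \<le> F 0" using slack_pairs[of p] by (simp add: F_def)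
  have eqs: "int s = int n + 1 + int r" "int n = int r + 2 * int p + int L"
    "int r = g * t - int L + int R"
    using s_eq n_eq r_eq by (simp_all add: g_def t_def algebra_simps)
  have "F t = int r * (int r + 1) - int R * (int R + 1) - (2 * int u + int L) * int s"
    unfolding F_def eqs by (simp add: t_def algebra_simps)
  then have "0 \<le> F t" using slack_nonneg_int by simp
  have i: "0 \<le> int i" "int i \<le> t" using assms by (simp_all add: t_def)
  \<comment> \<open>Interpolation between \<open>0\<close> and \<open>t\<close> for a quadratic with
    leading coefficient \<open>- g g\<close>.\<close>
  have "t * F (int i) = (t - int i) * F 0 + int i * F t + g * g * int i * t * (t - int i)"
    unfolding F_def by (simp add: algebra_simps)
  also have "0 \<le> \<dots>" using i \<open>0 \<le> F 0\<close> \<open>0 \<le> F t\<close> by (intro add_nonneg_nonneg mult_nonneg_nonneg) (auto simp: g_def)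
  finally have "0 \<le> t * F (int i)" .
  moreover have "0 < t" using u_pos by (simp add: t_def)
  ultimately show ?thesis by (simp add: F_def g_def zero_le_mult_iff)
qed (use u_pos in simp)

lemma slack_P:
  assumes "j \<le> k"
  shows "2 * int j * int s \<le> int (partial_sum P j) * (2 * int n - int (partial_sum P j) + 1)"
proof -
  consider "j \<le> p" | i where "j = p + i" "i \<le> u + L" | i where "j = p + u + L + (K - i)" "i \<le> K"
  proof -
    have "j = p + u + L + (K - (k - j))" "k - j \<le> K" if "p + u + L \<le> j"
      using that assms k_eq by auto
    moreover have "j = p + (j - p)" "j - p \<le> u + L" if "p \<le> j" "j \<le> p + u + L"
      using that by auto
    ultimately show ?thesis using that by (meson nat_le_linear)
  qed
  then show ?thesis
  proof cases
    case 1
    then have "partial_sum P j = 2 * j" by (simp add: partial_sum_def P_def sum_list_replicate)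
    then show ?thesis using slack_pairs[OF 1] by simp
  next
    case (2 i)
    then have "partial_sum P j = 2 * p + Suc G * i" by (simp add: partial_sum_def P_def sum_list_replicate min_def)
    then show ?thesis using slack_middle[OF 2(2)] 2(1) by (simp only: of_nat_add of_nat_mult of_nat_numeral)
  next
    case (3 i)
    \<comment> \<open>Here \<open>i\<close> counts the blocks still to come. As all numbers up to
      \<open>n\<close> sum to \<open>k s\<close>, nonnegative slack means that \<open>1..W\<close>
      sum to at most \<open>i s\<close>.\<close>
    define W where "W = i * h + min i e"
    have "sum_list (take (K - i) Q) + W = R"
      using sum_list_drop_Q[OF 3(2)] sum_list_Q by (metis W_def append_take_drop_id sum_list_append)
    then have W: "partial_sum P j + W = n"
      using 3(1) n_eq r_eq by (simp add: partial_sum_def P_def sum_list_replicate algebra_simps)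
    have "int (W * (W + 1)) \<le> int (2 * i * s)" using tail_sum_le[OF 3(2)] unfolding W_def by linarith
    then have le: "int W * (int W + 1) \<le> 2 * int i * int s" by (simp only: of_nat_add of_nat_mult of_nat_numeral of_nat_1)
    have k: "2 * int k * int s = int n * (int n + 1)" by (rule sum_eq_int)
    have "int k = int j + int i" using 3 k_eq by simp
    then have "2 * int j * int s = int n * (int n + 1) - 2 * int i * int s" using k by (simp add: algebra_simps)
    also have "\<dots> \<le> int n * (int n + 1) - int W * (int W + 1)" using le by simp
    also have "\<dots> = (int n - int W) * (2 * int n - (int n - int W) + 1)" by (simp add: algebra_simps)
    also have "int n - int W = int (partial_sum P j)" using W by linarith
    finally show ?thesis .
  qed
qed

lemma instance_P: "ESPP_instance n k P"
  using ESPP_instanceI[OF sum_eq n_pos k_pos composition slack_P] .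

section \<open>Unsolvability by counting\<close>

lemma not_solvable: "\<not> ESPP_solvable n k P"
proof
  assume "ESPP_solvable n k P"
  then obtain A where disj: "disjoint_family_on A {..<k}" and un: "(\<Union>j<k. A j) = {1..n}"
    and A: "\<And>j. j < k \<Longrightarrow> card (A j) = P ! j \<and> \<Sum>(A j) = target_sum n k"
    unfolding ESPP_solvable_def by blast
  have sumA: "\<Sum>(A j) = s" if "j < k" for j using A[OF that] target_sum_eqI[OF sum_eq k_pos] by simp
  have finA: "finite (A j)" if "j < k" for j using un that finite_subset[of "A j" "{1..n}"] by blast
  have subA: "A j \<subseteq> {1..n}" if "j < k" for j using un that by blast
  have cardA2: "card (A j) = 2" if "j < p" for j
    using that A[of j] k_eq by (simp add: P_def nth_append)
  have cardA: "card (A j) = Suc G" if "p \<le> j" "j < p + u + L" for j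
  proof -
    have "P ! j = Suc G" using that by (simp add: P_def nth_append less_diff_conv2)
    then show ?thesis using that A[of j] k_eq by simp
  qed
  \<comment> \<open>Two numbers up to \<open>n\<close> with sum \<open>s\<close> are both at least
    \<open>s - n = r + 1\<close>.\<close>
  have pair: "A j \<subseteq> {r+1..n}" if j: "j < p" for j
  proof
    fix x assume x: "x \<in> A j"
    have jk: "j < k" using j k_eq by simp
    obtain y z where "A j = {y, z}" "y \<noteq> z" using cardA2[OF j] by (meson card_2_iff)
    then have "y + z = s" "y \<le> n" "z \<le> n" "x = y \<or> x = z" using sumA[OF jk] subA[OF jk] x by auto
    then show "x \<in> {r+1..n}" using s_eq by auto
  qed
  define F where "F = {r+1..n} - (\<Union>j<p. A j)"
  have cardF: "card F = L"
  proof -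
    have "card (\<Union>j<p. A j) = (\<Sum>j<p. card (A j))"
    proof (rule card_UN_disjoint)
      show "\<forall>i\<in>{..<p}. \<forall>j\<in>{..<p}. i \<noteq> j \<longrightarrow> A i \<inter> A j = {}"
        using disj k_eq unfolding disjoint_family_on_def by auto
    qed (use finA k_eq in auto)
    then have "card (\<Union>j<p. A j) = 2 * p" using cardA2 by simp
    moreover have "(\<Union>j<p. A j) \<subseteq> {r+1..n}" using pair by blast
    ultimately show ?thesis using n_eq unfolding F_def
      by (subst card_Diff_subset) (auto intro: finite_subset)
  qed
  define T where "T = {p..<p + u + L}"
  define I where "I = {j \<in> T. A j \<inter> {r+1..n} \<noteq> {}}"
  \<comment> \<open>A representative in \<open>{r+1..n}\<close> for each block of \<open>T\<close>
    that meets this set. Disjointness makes \<open>f\<close> injective with values outside the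
    pairs, so at most \<open>L\<close> blocks meet it.\<close>
  define f where "f = (\<lambda>j. SOME x. x \<in> A j \<inter> {r+1..n})"
  have f: "f j \<in> A j \<inter> {r+1..n}" if "j \<in> I" for j
    using that unfolding I_def f_def by (metis (mono_tags, lifting) CollectD ex_in_conv someI_ex)
  have Tk: "j < k" if "j \<in> T" for j using that k_eq by (simp add: T_def)
  have "card I \<le> card F"
  proof (rule card_inj_on_le)
    show "inj_on f I"
    proof (rule inj_onI, rule ccontr)
      fix i j assume ij: "i \<in> I" "j \<in> I" "f i = f j" "i \<noteq> j"
      then have "i < k" "j < k" using Tk by (auto simp: I_def)
      then have "A i \<inter> A j = {}" using disj ij(4) by (auto simp: disjoint_family_on_def)
      then show False using f[OF ij(1)] f[OF ij(2)] ij(3) by auto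
    qed
    show "f ` I \<subseteq> F"
    proof clarify
      fix j assume j: "j \<in> I"
      then have "j < k" "p \<le> j" using Tk by (auto simp: I_def T_def)
      then have "A j \<inter> A i = {}" if "i < p" for i
        using disj that by (auto simp: disjoint_family_on_def)
      then show "f j \<in> F" using f[OF j] by (auto simp: F_def)
    qed
  qed (simp add: F_def)
  then have "u \<le> card (T - I)"
    using cardF by (subst card_Diff_subset) (auto simp: I_def T_def)
  then obtain U where U: "U \<subseteq> T - I" "card U = u" "finite U" by (meson obtain_subset_with_card_n)
  define S where "S = (\<Union>j\<in>U. A j)"
  have Uk: "j < k" if "j \<in> U" for j using that U Tk by auto
  have dU: "\<forall>i\<in>U. \<forall>j\<in>U. i \<noteq> j \<longrightarrow> A i \<inter> A j = {}"
    using disj Uk by (auto simp: disjoint_family_on_def)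
  have "card S = (\<Sum>j\<in>U. card (A j))" unfolding S_def
    using U(3) dU finA Uk by (intro card_UN_disjoint) auto
  also have "\<dots> = (\<Sum>j\<in>U. Suc G)" using U(1) by (intro sum.cong refl cardA) (auto simp: T_def)
  finally have cS: "card S = Suc G * u" using U(2) by simp
  have "\<Sum>S = (\<Sum>j\<in>U. \<Sum>(A j))" unfolding S_def
    using U(3) dU finA Uk by (intro sum.UNION_disjoint) auto
  also have "\<dots> = u * s" using U(2) sumA Uk by simp
  finally have sS: "\<Sum>S = u * s" .
  have "S \<subseteq> {1..r}"
  proof
    fix x assume "x \<in> S"
    then obtain j where j: "j \<in> U" "x \<in> A j" by (auto simp: S_def)
    then have "x \<in> {1..n}" "A j \<inter> {r+1..n} = {}" using subA[OF Uk[OF j(1)]] U(1) by (auto simp: I_def)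
    then show "x \<in> {1..r}" using j(2) by (cases "x \<le> r") auto
  qed
  \<comment> \<open>Cancelling \<open>u\<close> contradicts \<open>crowded\<close>.\<close>
  from sum_subset_le[OF this] have "u * (2 * s + Suc G * Suc G * u) \<le> u * (2 * Suc G * r + Suc G)"
    unfolding cS sS by (simp add: algebra_simps)
  then show False using crowded u_pos by (simp only: mult_le_cancel1) auto
qed

end

section \<open>Parameters for large \<open>N\<close>\<close>

text \<open>With \<open>N = n + 1\<close> the common sum is \<open>a N / 2\<close> and \<open>r = (a / 2 - 1) N\<close>.\<close>

definition admissible :: "real \<Rightarrow> nat \<Rightarrow> nat \<Rightarrow> real \<Rightarrow> nat \<Rightarrow> bool" where
  "admissible a G L N u \<longleftrightarrow>
     (let s = a / 2 * N; r = (a / 2 - 1) * N; R = r - (real G + 1) * real u - real G * real L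
      in 0 < u \<and> 2 * (real G + 1) * r + (real G + 1) < 2 * s + (real G + 1)\<^sup>2 * real u \<and>
         (2 * real u + real L) * s + R * (R + 1) \<le> r * (r + 1) \<and> real G * real L + 1 \<le> R)"

lemma eventually_ge_linear:
  fixes c d :: real
  assumes "0 < c"
  shows "\<forall>\<^sub>F x in at_top. d \<le> c * x"
  using eventually_ge_at_top[of "d / c"] by eventually_elim (use assms in \<open>simp add: field_simps\<close>)

lemma admissible_low:
  fixes a :: real
  assumes "2 < a" "a \<le> 3"
  shows "\<exists>G\<ge>2. \<forall>\<^sub>F L in sequentially. \<forall>\<^sub>F N in at_top. \<exists>u. admissible a G L N u"
proof -
  \<comment> \<open>The largest \<open>G\<close> with \<open>G (a - 2) \<le> 2\<close>. This bound
    gives \<open>2 g r \<le> 2 s\<close>, so crowding holds with \<open>u = 1\<close>;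
    \<open>a \<le> 3\<close> ensures \<open>G \<ge> 2\<close>.\<close>
  define G where "G = nat \<lfloor>2 / (a - 2)\<rfloor>"
  have "2 \<le> 2 / (a - 2)" using assms by (simp add: field_simps)
  then have "2 \<le> \<lfloor>2 / (a - 2)\<rfloor>" by (simp add: le_floor_iff)
  then have G2: "2 \<le> G" and G: "real G = of_int \<lfloor>2 / (a - 2)\<rfloor>" unfolding G_def by linarith+
  have "real G \<le> 2 / (a - 2)" "2 / (a - 2) < real G + 1" unfolding G by linarith+
  then have up: "real G * (a - 2) \<le> 2" and lo: "2 < (real G + 1) * (a - 2)"
    using assms by (simp_all add: field_simps)
  define \<beta> where "\<beta> = real G * (a - 2) - a / 2"
  \<comment> \<open>For \<open>a \<le> 8 / 3\<close> maximality of \<open>G\<close> gives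
    \<open>G (a - 2) > 4 - a \<ge> a / 2\<close>; beyond that \<open>G \<ge> 2\<close>
    suffices.\<close>
  have \<beta>: "0 < \<beta>"
  proof (cases "a \<le> 8 / 3")
    case True
    then show ?thesis using lo by (simp add: \<beta>_def algebra_simps)
  next
    case False
    moreover have "2 * (a - 2) \<le> real G * (a - 2)" using G2 assms by (intro mult_right_mono) auto
    ultimately show ?thesis by (simp add: \<beta>_def)
  qed
  have "\<forall>\<^sub>F L in sequentially. a / \<beta> \<le> real L"
    using filterlim_real_sequentially unfolding filterlim_at_top by blast
  then have "\<forall>\<^sub>F L in sequentially. \<forall>\<^sub>F N in at_top. admissible a G L N 1"
  proof eventually_elim
    case (elim L)
    define w where "w = real G + 1 + real G * real L"
    \<comment> \<open>The doubled slack is \<open>c N - w (w - 1)\<close>, and \<open>L\<close>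
      enters \<open>c\<close> with coefficient \<open>\<beta>\<close>.\<close>
    define c where "c = w * (a - 2) - (2 + real L) * (a / 2)"
    have "a \<le> \<beta> * real L" using elim \<beta> by (simp add: field_simps)
    moreover have "c = \<beta> * real L + (real G + 1) * (a - 2) - a"
      by (simp add: c_def w_def \<beta>_def field_simps)
    moreover have "0 < (real G + 1) * (a - 2)" using assms by simp
    ultimately have c: "0 < c" by linarith
    have a: "0 < a / 2 - 1" using assms by simp
    have "\<forall>\<^sub>F N in at_top. w * (w - 1) \<le> c * N" "\<forall>\<^sub>F N in at_top. w + real G * real L + 1 \<le> (a / 2 - 1) * N"
      using eventually_ge_linear c a by blast+
    with eventually_ge_at_top[of 0] show ?case
    proof eventually_elim
      case (elim N)
      define g where "g = real G + 1"
      have "real G * (a - 2) * N \<le> 2 * N" using up elim(1) by (intro mult_right_mono) auto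
      then have "2 * g * ((a / 2 - 1) * N) \<le> 2 * (a / 2 * N)"
        by (simp add: g_def field_simps)
      moreover have "1 * g < g * g" using G2 by (intro mult_strict_right_mono) (auto simp: g_def)
      ultimately have "2 * g * ((a / 2 - 1) * N) + g < 2 * (a / 2 * N) + g\<^sup>2"
        by (simp add: power2_eq_square)
      moreover have "(2 + real L) * (a / 2 * N) + ((a / 2 - 1) * N - w) * ((a / 2 - 1) * N - w + 1)
          \<le> (a / 2 - 1) * N * ((a / 2 - 1) * N + 1)"
        using elim(2) unfolding c_def by (simp add: field_simps)
      moreover have R: "(a / 2 - 1) * N - (real G + 1) * real 1 - real G * real L = (a / 2 - 1) * N - w"
        by (simp add: w_def)
      ultimately show ?case
        unfolding admissible_def Let_def R using elim(3) by (simp add: g_def)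
    qed
  qed
  then have "\<forall>\<^sub>F L in sequentially. \<forall>\<^sub>F N in at_top. \<exists>u. admissible a G L N u"
    by (elim eventually_mono) (auto elim: eventually_mono)
  with G2 show ?thesis by blast
qed

lemma admissible_high:
  fixes a :: real
  assumes "3 < a" "a < 24 / 7"
  shows "\<forall>\<^sub>F L in sequentially. \<forall>\<^sub>F N in at_top. \<exists>u. admissible a 2 L N u"
proof -
  define \<beta> where "\<beta> = 4 - 7 * a / 6"
  have \<beta>: "0 < \<beta>" using assms by (simp add: \<beta>_def)
  have "\<forall>\<^sub>F L in sequentially. 3 / \<beta> \<le> real L"
    using filterlim_real_sequentially unfolding filterlim_at_top by blast
  then show ?thesis
  proof eventually_elim
    case (elim L)
    then have L: "3 \<le> \<beta> * real L" using \<beta> by (simp add: field_simps)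
    have "0 < 1 - a / 6" using assms by simp
    then have "\<forall>\<^sub>F N in at_top. 4 * real L + 5 \<le> (1 - a / 6) * N"
      by (rule eventually_ge_linear)
    with eventually_ge_at_top[of "12 + 14 * real L + 4 * real L * real L"] show ?case
    proof eventually_elim
      case (elim N)
      have "0 \<le> real L * real L" by simp
      then have N: "0 \<le> N" using elim(1) by linarith
      define y where "y = (2 * (a - 3) * N + 3) / 9"
      have y: "0 \<le> y" using N assms by (simp add: y_def)
      \<comment> \<open>The least integer above \<open>y\<close>, that is, the least
        \<open>u\<close> satisfying the crowding inequality.\<close>
      define u where "u = Suc (nat \<lfloor>y\<rfloor>)"
      have "real u = of_int \<lfloor>y\<rfloor> + 1" using y by (simp add: u_def)
      then have "y < real u" "real u \<le> y + 1" by linarith+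
      then have lo: "2 * (a - 3) * N + 3 < 9 * real u" and up: "9 * real u \<le> 2 * (a - 3) * N + 12"
        by (simp_all add: y_def field_simps)
      define s where "s = a / 2 * N"
      define r where "r = (a / 2 - 1) * N"
      have rs: "6 * r - 2 * s = 2 * (a - 3) * N" by (simp add: r_def s_def field_simps)
      have "2 * (a - 3) * N \<le> 2 * 1 * N" using N assms by (intro mult_right_mono) auto
      then have u9: "9 * real u \<le> 2 * N + 12" using up by linarith
      \<comment> \<open>Minimality of \<open>u\<close> limits the deficit to
        \<open>9 u \<le> 2 N + 12\<close>. The \<open>L\<close> term gains about
        \<open>\<beta> L N \<ge> 3 N\<close>, which wins for large \<open>N\<close>.\<close>
      have "-9 * real u \<le> (6 * r - 2 * s + 3 - 9 * real u) * real u"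
        using up by (intro mult_right_mono) (auto simp: rs)
      moreover have "(\<beta> * N - 14 - 4 * real L) * real L \<le> (4 * r - s - 12 * real u + 2 - 4 * real L) * real L"
        using up by (intro mult_right_mono) (auto simp: r_def s_def \<beta>_def field_simps)
      moreover have "3 * N \<le> \<beta> * real L * N" using L N by (intro mult_right_mono) auto
      then have "3 * N - 14 * real L - 4 * real L * real L \<le> (\<beta> * N - 14 - 4 * real L) * real L"
        by (simp add: algebra_simps)
      ultimately have "0 \<le> (6 * r - 2 * s + 3 - 9 * real u) * real u + (4 * r - s - 12 * real u + 2 - 4 * real L) * real L"
        using u9 elim(1) by linarith
      moreover define R where "R = r - 3 * real u - 2 * real L"
      have "r * (r + 1) - R * (R + 1) - (2 * real u + real L) * s
        = (6 * r - 2 * s + 3 - 9 * real u) * real u + (4 * r - s - 12 * real u + 2 - 4 * real L) * real L"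
        unfolding R_def by (simp add: algebra_simps)
      ultimately have "(2 * real u + real L) * s + R * (R + 1) \<le> r * (r + 1)"
        by linarith
      moreover have "6 * r + 3 < 2 * s + 9 * real u" using lo rs by linarith
      moreover have "2 * real L + 1 \<le> R"
        using up elim(2) by (simp add: R_def r_def field_simps)
      ultimately have "admissible a 2 L N u"
        by (simp add: admissible_def Let_def u_def R_def r_def s_def)
      then show ?case by blast
    qed
  qed
qed

lemma admissible_exists:
  fixes a :: real
  assumes "2 < a" "a < 24 / 7"
  shows "\<exists>G\<ge>2. \<forall>\<^sub>F L in sequentially. \<forall>\<^sub>F N in at_top. \<exists>u. admissible a G L N u"
  using admissible_low[of a] admissible_high[of a] assms by (cases "a \<le> 3") auto

lemma unsolvable_of_admissible:
  fixes a :: real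
  assumes adm: "admissible a G L (real n + 1) u" and "2 < a" "2 \<le> G"
    and sum_eq: "2 * k * s = n * (n + 1)" and s: "real s = a / 2 * (real n + 1)"
    and L: "s + L \<le> 2 * n + 1" "even (2 * n + 1 - s - L)"
  shows "\<exists>P. ESPP_instance n k P \<and> \<not> ESPP_solvable n k P"
proof -
  have "1 * (real n + 1) \<le> a / 2 * (real n + 1)" using assms by (intro mult_right_mono) auto
  then have "real (n + 1) \<le> real s" using s by simp
  then have sn: "n + 1 \<le> s" by (simp only: of_nat_le_iff)
  define r where "r = s - (n + 1)"
  have r: "(a / 2 - 1) * (real n + 1) = real r"
    using sn s by (simp add: r_def of_nat_diff algebra_simps)
  note adm' = adm[unfolded admissible_def Let_def r s[symmetric]]
  have "real (Suc G * u + G * L) \<le> real r"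
  proof -
    have "0 \<le> real G * real L" by simp
    moreover have "real G * real L + 1 \<le> real r - (real G + 1) * real u - real G * real L"
      using adm' by blast
    moreover have "real (Suc G * u + G * L) = (real G + 1) * real u + real G * real L"
      by (simp add: algebra_simps)
    ultimately show ?thesis by linarith
  qed
  then have le: "Suc G * u + G * L \<le> r" by linarith
  define R where "R = r - (Suc G * u + G * L)"
  have R: "real r - (real G + 1) * real u - real G * real L = real R"
    using le by (simp add: R_def of_nat_diff algebra_simps)
  \<comment> \<open>Since \<open>2 n + 1 - s = n - r\<close>, the parity assumption lets pairs fill
    \<open>{r+1..n}\<close> up to exactly \<open>L\<close> elements.\<close>
  obtain p where p: "2 * n + 1 - s - L = 2 * p" using L(2) by blast
  interpret crowded_blocks n k s r p u L G R
  proof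
    show "s = n + 1 + r" "n = r + 2 * p + L" using sn L(1) p by (simp_all add: r_def)
    show "r = Suc G * u + G * L + R" using le by (simp add: R_def)
    have "real (G * L + 1) \<le> real R" using adm' unfolding R by simp
    then have "G * L + 1 \<le> R" by linarith
    then show "0 < R" "G * L \<le> R" by simp_all
    have "real (2 * Suc G * r + Suc G) < real (2 * s + Suc G * Suc G * u)"
      using adm' by (simp only: power2_eq_square of_nat_add of_nat_mult of_nat_numeral of_nat_Suc add.commute)
    then show "2 * Suc G * r + Suc G < 2 * s + Suc G * Suc G * u" by (simp only: of_nat_less_iff)
    have "real ((2 * u + L) * s + R * (R + 1)) \<le> real (r * (r + 1))"
      using adm' unfolding R by (simp only: of_nat_add of_nat_mult of_nat_numeral of_nat_1)
    then show "(2 * u + L) * s + R * (R + 1) \<le> r * (r + 1)" by (simp only: of_nat_le_iff)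
  qed (use adm' sum_eq \<open>2 \<le> G\<close> in auto)
  show ?thesis using instance_P not_solvable by blast
qed

section \<open>Arbitrarily large instances of a given ratio\<close>

text \<open>For \<open>a = \<alpha> / b\<close> in lowest terms take \<open>n = \<alpha> z\<close>
  and \<open>k = b z\<close>; divisibility then amounts to
  \<open>2 b dvd \<alpha> (\<alpha> z + 1)\<close>.\<close>

lemma exists_ratio:
  fixes a :: rat
  assumes "0 < a"
  shows "\<exists>n k s. B \<le> n \<and> 0 < k \<and> of_nat n / of_nat k = a \<and> 2 * k * s = n * (n + 1)"
proof -
  obtain p q where "quotient_of a = (p, q)" by fastforce
  then have pq: "a = of_int p / of_int q" "0 < q" "coprime p q"
    using quotient_of_div quotient_of_denom_pos quotient_of_coprime by blast+
  then have "0 < p" using assms by (simp add: zero_less_divide_iff)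
  obtain \<alpha> b where "p = int \<alpha>" "q = int b"
    using \<open>0 < p\<close> \<open>0 < q\<close> by (meson less_imp_le nonneg_int_cases)
  then have \<alpha>b: "0 < \<alpha>" "0 < b" "coprime \<alpha> b" "a = of_nat \<alpha> / of_nat b"
    using pq \<open>0 < p\<close> by simp_all
  \<comment> \<open>An even \<open>\<alpha>\<close> already supplies the factor \<open>2\<close>; in
    both cases \<open>m\<close> is coprime to \<open>\<alpha>\<close>, so
    \<open>\<alpha> z = -1\<close> is solvable modulo \<open>m\<close>.\<close>
  define m where "m = (if odd \<alpha> then 2 * b else b)"
  have m: "coprime m \<alpha>" "0 < m" using \<alpha>b by (auto simp: m_def coprime_commute)
  obtain d x y where "d dvd m" "d dvd \<alpha>" "m * x = \<alpha> * y + d"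
    using bezout_add_strong_nat[of m \<alpha>] m by auto
  then have "m dvd \<alpha> * y + 1" using m(1) by (metis coprime_common_divisor_nat dvd_triv_left)
  then have "m dvd (\<alpha> * y + 1) + m * (\<alpha> * (B + 1))"
    by (rule dvd_add) (rule dvd_triv_left)
  moreover define z where "z = y + m * (B + 1)"
  ultimately have z: "m dvd \<alpha> * z + 1" by (simp add: algebra_simps)
  have "2 * b dvd \<alpha> * (\<alpha> * z + 1)"
  proof (cases "odd \<alpha>")
    case True
    then show ?thesis using z by (intro dvd_mult) (simp only: m_def if_True not_False_eq_True)
  next
    case False
    then show ?thesis using z by (intro mult_dvd_mono) (auto simp: m_def)
  qed
  then obtain s where s: "\<alpha> * (\<alpha> * z + 1) = 2 * b * s" by (elim dvdE)
  have "1 * (B + 1) \<le> m * (B + 1)" using m by (intro mult_le_mono1) auto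
  then have zB: "B < z" by (simp add: z_def)
  have "1 * z \<le> \<alpha> * z" using \<alpha>b by (intro mult_le_mono1) auto
  then have "B \<le> \<alpha> * z" using zB by linarith
  moreover have "0 < b * z" using \<alpha>b zB by simp
  moreover have "of_nat (\<alpha> * z) / of_nat (b * z) = a" using zB \<alpha>b by simp
  moreover have "2 * (b * z) * s = \<alpha> * z * (\<alpha> * z + 1)"
    using s[THEN arg_cong[where f = "\<lambda>x. x * z"]] by (simp only: ac_simps)
  ultimately show ?thesis by blast
qed

theorem theorem1p10:
  fixes a :: rat
  assumes "2 < a" and "a < 24 / 7"
  shows "infinite {(n, k, P). ESPP_instance n k P \<and> of_nat n / of_nat k = a \<and>
                     \<not> ESPP_solvable n k P}"
    (is "infinite ?X")
proof
  assume "finite ?X"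
  then have fin: "finite (fst ` ?X)" by simp
  define c :: real where "c = of_rat a"
  have c: "2 < c" "c < 24 / 7"
    using assms of_rat_less[of 2 a, where 'a = real] of_rat_less[of a "24 / 7", where 'a = real]
    by (simp_all add: c_def of_rat_divide)
  obtain G where G: "2 \<le> G" and ev: "\<forall>\<^sub>F L in sequentially. \<forall>\<^sub>F N in at_top. \<exists>u. admissible c G L N u"
    using admissible_exists[OF c] by blast
  then obtain L0 where L0: "\<And>L. L0 \<le> L \<Longrightarrow> \<forall>\<^sub>F N in at_top. \<exists>u. admissible c G L N u"
    unfolding eventually_sequentially by blast
  \<comment> \<open>Two consecutive values of \<open>L\<close> are kept available, since the parity
    of \<open>2 n + 1 - s\<close> is known only after \<open>n\<close> is chosen. The last conjunct
    makes room for \<open>L\<close> elements in \<open>{r+1..n}\<close>.\<close>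
  have "\<forall>\<^sub>F N in at_top. (\<exists>u. admissible c G L0 N u) \<and> (\<exists>u. admissible c G (Suc L0) N u)
      \<and> real L0 + 2 \<le> (2 - c / 2) * N"
    using c by (intro eventually_conj L0 eventually_ge_linear) auto
  then obtain N0 where N0: "\<And>N. N0 \<le> N \<Longrightarrow> (\<exists>u. admissible c G L0 N u) \<and> (\<exists>u. admissible c G (Suc L0) N u)
      \<and> real L0 + 2 \<le> (2 - c / 2) * N"
    unfolding eventually_at_top_linorder by blast
  from fin obtain B where B: "\<forall>n\<in>fst ` ?X. n < B"
    unfolding finite_nat_set_iff_bounded ..
  obtain n k s where n: "max B (nat \<lceil>N0\<rceil>) \<le> n" and k: "0 < k" "of_nat n / of_nat k = a"
    and sum: "2 * k * s = n * (n + 1)"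
    using exists_ratio[of a "max B (nat \<lceil>N0\<rceil>)"] less_trans[OF zero_less_numeral assms(1)] by blast
  have ck: "c * real k = real n"
  proof -
    have "c = real n / real k" unfolding c_def k(2)[symmetric] by (simp add: of_rat_divide)
    then show ?thesis using k(1) by simp
  qed
  have "real (2 * k * s) = real (n * (n + 1))" by (simp only: sum)
  then have "real k * (2 * real s) = real k * (c * (real n + 1))"
    using ck by (simp add: algebra_simps)
  then have s: "real s = c / 2 * (real n + 1)" using k by simp
  have large: "N0 \<le> real n + 1" using n by linarith
  have "real L0 + 2 \<le> 2 * (real n + 1) - real s"
    using N0[OF large] unfolding s by (simp add: algebra_simps)
  then have "real (s + Suc L0) \<le> real (2 * n + 1)" by simp
  then have le: "s + Suc L0 \<le> 2 * n + 1" by (simp only: of_nat_le_iff)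
  obtain L where L: "L = L0 \<or> L = Suc L0" "even (2 * n + 1 - s - L)"
  proof (cases "even (2 * n + 1 - s - L0)")
    case False
    then have "even (2 * n + 1 - s - Suc L0)" using le by auto
    then show ?thesis using that by blast
  qed (use that in blast)
  then obtain u where u: "admissible c G L (real n + 1) u" using N0[OF large] by blast
  obtain P where "ESPP_instance n k P" "\<not> ESPP_solvable n k P"
    using unsolvable_of_admissible[OF u c(1) G sum s _ L(2)] le L(1) by auto
  then have "(n, k, P) \<in> ?X" using k by simp
  then have "n \<in> fst ` ?X" by (rule image_eqI[rotated]) simp
  with B have "n < B" by (rule bspec)
  then show False using n by simp
qed

end
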